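(* For every integer $n\geq 2$ with $n\neq 3$ we have $E_{\mathbb Z_n',\{1\}}(n)=n+1$.
   Context: $\mathbb Z_n=\mathbb Z/n\mathbb Z$ as a module over itself and $\mathbb Z_n'=\mathbb Z_n\setminus\{0\}$. A subsequence is a non-empty subfamily of terms in the original order. For non-empty $A,B\subseteq\mathbb Z_n$, a sequence $(x_1,\ldots,x_k)$ is an $(A,B)$-weighted zero-sum sequence if there exist $a_i\in A$, $b_i\in B$ with $\sum a_ix_i=0$ and $\sum b_ia_i=0$. $E_{A,B}(n)$ is the least positive $k$ such that every sequence in $\mathbb Z_n$ of length $k$ has an $(A,B)$-weighted zero-sum subsequence of length $n$. *)

theory Defs
  imports "HOL-Number_Theory.Residues" "HOL-Library.Sublist"
begin

abbreviation Zmod :: "nat \<Rightarrow> int ring" where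
  "Zmod n \<equiv> residue_ring (int n)"

definition weighted_zero_sum :: "nat \<Rightarrow> int set \<Rightarrow> int set \<Rightarrow> int list \<Rightarrow> bool" where
  "weighted_zero_sum n A B xs \<longleftrightarrow>
     (\<exists>a b. (\<forall>i<length xs. a i \<in> A \<and> b i \<in> B) \<and>
        (\<Oplus>\<^bsub>Zmod n\<^esub>i\<in>{..<length xs}. a i \<otimes>\<^bsub>Zmod n\<^esub> xs ! i) = \<zero>\<^bsub>Zmod n\<^esub> \<and>
        (\<Oplus>\<^bsub>Zmod n\<^esub>i\<in>{..<length xs}. b i \<otimes>\<^bsub>Zmod n\<^esub> a i) = \<zero>\<^bsub>Zmod n\<^esub>)"

text \<open>
  The infimum of a non-empty set of natural numbers is its least element. The infimum of the
  empty set is \<open>0\<close>, so a positive value of \<open>E_const\<close> entails that an admissible length exists.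
\<close>

definition E_const :: "int set \<Rightarrow> int set \<Rightarrow> nat \<Rightarrow> nat" where
  "E_const A B n = Inf {k. 0 < k \<and>
     (\<forall>xs. set xs \<subseteq> carrier (Zmod n) \<and> length xs = k \<longrightarrow>
        (\<exists>ys. ys \<noteq> [] \<and> subseq ys xs \<and> length ys = n \<and> weighted_zero_sum n A B ys))}"

end

theory Submission imports Defs "HOL-Library.Multiset" begin

text \<open>
  Weights \<open>y - z\<close>, \<open>z - x\<close>, \<open>x - y\<close> solve both equations for three distinct terms \<open>x, y, z\<close>, and
  weights \<open>1, -1\<close> solve them for two equal terms. For \<open>n \<ge> 3\<close> a nonzero weight is a sum of two
  nonzero weights, so a solvable sequence stays solvable when one of its terms is repeated. Hence a
  sequence is solvable as soon as the number of its distinct values, some of the values of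
  multiplicity at least 2 being disregarded, is divisible by 3. For \<open>n \<ge> 4\<close>, inspecting the number
  of terms of multiplicity 1 modulo 3 shows that one term of any sequence of length \<open>n + 1\<close> can be
  deleted so that this criterion applies. The sequence \<open>0, \<dots>, 0, 1\<close> of length \<open>n\<close> is not solvable.
\<close>

section \<open>Solvable multisets of integers modulo m\<close>

text \<open>\<open>W\<close> attaches a weight to each occurrence, so equal terms may carry
  different weights. Weights are integers not divisible by \<open>m\<close>, not reduced residues,
  so differences and negatives need no normalisation. Since all \<open>b\<close> are 1, the second
  equation is the vanishing of the sum of the weights.\<close>

definition balanced :: "int \<Rightarrow> int multiset \<Rightarrow> bool" where
  "balanced m M \<longleftrightarrow> (\<exists>W. image_mset fst W = M \<and> (\<forall>(x, a)\<in>#W. \<not> m dvd a) \<and>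
     m dvd (\<Sum>(x, a)\<in>#W. a) \<and> m dvd (\<Sum>(x, a)\<in>#W. a * x))"

lemma balancedI:
  assumes "image_mset fst W = M" "\<And>x a. (x, a) \<in># W \<Longrightarrow> \<not> m dvd a"
    "m dvd (\<Sum>(x, a)\<in>#W. a)" "m dvd (\<Sum>(x, a)\<in>#W. a * x)"
  shows "balanced m M"
  using assms unfolding balanced_def by (intro exI[of _ W]) auto

lemma balancedE:
  assumes "balanced m M"
  obtains W where "image_mset fst W = M" "\<forall>(x, a)\<in>#W. \<not> m dvd a"
    "m dvd (\<Sum>(x, a)\<in>#W. a)" "m dvd (\<Sum>(x, a)\<in>#W. a * x)"
  using assms unfolding balanced_def by blast

lemma balanced_empty: "balanced m {#}"
  by (rule balancedI[of "{#}"]) auto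

lemma balanced_add:
  assumes "balanced m M" "balanced m N"
  shows "balanced m (M + N)"
proof -
  obtain V where V: "image_mset fst V = M" "\<forall>(x, a)\<in>#V. \<not> m dvd a"
    "m dvd (\<Sum>(x, a)\<in>#V. a)" "m dvd (\<Sum>(x, a)\<in>#V. a * x)"
    using assms(1) by (rule balancedE)
  obtain W where W: "image_mset fst W = N" "\<forall>(x, a)\<in>#W. \<not> m dvd a"
    "m dvd (\<Sum>(x, a)\<in>#W. a)" "m dvd (\<Sum>(x, a)\<in>#W. a * x)"
    using assms(2) by (rule balancedE)
  show ?thesis
    by (rule balancedI[of "V + W"]) (use V W in auto)
qed

lemma balanced_pair:
  assumes "m \<ge> 2"
  shows "balanced m {#x, x#}"
  by (rule balancedI[of "{#(x, 1), (x, -1)#}"]) (use assms in auto)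

lemma not_dvd_diff:
  fixes m x y :: int
  assumes "x \<in> {0..<m}" "y \<in> {0..<m}" "x \<noteq> y"
  shows "\<not> m dvd x - y"
proof
  assume "m dvd x - y"
  then have "x mod m = y mod m" by (simp add: mod_eq_dvd_iff)
  then show False using assms by simp
qed

lemma balanced_triple:
  assumes "{x, y, z} \<subseteq> {0..<m}" "x \<noteq> y" "y \<noteq> z" "x \<noteq> z"
  shows "balanced m {#x, y, z#}"
proof (rule balancedI[of "{#(x, y - z), (y, z - x), (z, x - y)#}"])
  show "\<not> m dvd a" if "(w, a) \<in># {#(x, y - z), (y, z - x), (z, x - y)#}" for w a
    using that assms not_dvd_diff by fastforce
qed (auto simp: algebra_simps)

text \<open>Cut \<open>D\<close> into triples of distinct residues, solve each triple separately and
  add the solutions.\<close>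

lemma balanced_mset_set:
  assumes "D \<subseteq> {0..<m}" "3 dvd card D"
  shows "balanced m (mset_set D)"
  using assms
proof (induction "card D" arbitrary: D rule: less_induct)
  case less
  have fin: "finite D" using less.prems(1) by (rule finite_subset) simp
  show ?case
  proof (cases "D = {}")
    case True
    then show ?thesis by (simp add: balanced_empty)
  next
    case False
    then have "3 \<le> card D" using less.prems(2) fin by (intro dvd_imp_le) (auto simp: card_gt_0_iff)
    then obtain T where T: "T \<subseteq> D" "card T = 3" by (rule obtain_subset_with_card_n)
    then obtain x y z where xyz: "T = {x, y, z}" "x \<noteq> y" "y \<noteq> z" "x \<noteq> z"
      by (auto simp: card_3_iff)
    have finT: "finite T" using xyz by simp
    have card: "card (D - T) = card D - 3" using T finT by (simp add: card_Diff_subset)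
    have "balanced m (mset_set (D - T))"
      using less.prems card \<open>3 \<le> card D\<close> by (intro less.hyps) auto
    moreover have "balanced m (mset_set T)"
    proof -
      have "mset_set T = {#x, y, z#}" using xyz by simp
      moreover have "{x, y, z} \<subseteq> {0..<m}" using xyz(1) T(1) less.prems(1) by blast
      ultimately show ?thesis using balanced_triple[of x y z m] xyz by simp
    qed
    ultimately have "balanced m (mset_set (D - T) + mset_set T)" by (rule balanced_add)
    also have "mset_set (D - T) + mset_set T = mset_set D"
      using T fin finT by (metis mset_set_Diff subset_imp_msubset_mset_set subset_mset.diff_add)
    finally show ?thesis .
  qed
qed

section \<open>Repeated terms and the divisibility criterion\<close>

text \<open>The choice 1 works unless \<open>a\<close> is congruent to 1; then -1 works, since it
  leaves 2, which is nonzero because \<open>m\<close> is at least 3. Modulo 2 the weight 1 has no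
  such splitting.\<close>

lemma split_nonzero_weight:
  fixes m a :: int
  assumes "m \<ge> 3"
  obtains b where "\<not> m dvd b" "\<not> m dvd a - b"
proof (cases "m dvd a - 1")
  case True
  have "\<not> m dvd a - (-1)"
  proof
    assume "m dvd a - (-1)"
    then have "m dvd (a - (-1)) - (a - 1)" using True by (rule dvd_diff)
    then show False using assms zdvd_imp_le[of m 2] by simp
  qed
  then show ?thesis using assms that[of "-1"] by simp
next
  case False
  then show ?thesis using assms that[of 1] by simp
qed

lemma balanced_add_mset:
  assumes "m \<ge> 3" "balanced m M" "x \<in># M"
  shows "balanced m (add_mset x M)"
proof -
  obtain W where W: "image_mset fst W = M" "\<forall>(x, a)\<in>#W. \<not> m dvd a"
    "m dvd (\<Sum>(x, a)\<in>#W. a)" "m dvd (\<Sum>(x, a)\<in>#W. a * x)"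
    using assms(2) by (rule balancedE)
  then obtain a where "(x, a) \<in># W" using assms(3) by auto
  then obtain V where V: "W = add_mset (x, a) V" by (rule mset_add)
  obtain b where "\<not> m dvd b" "\<not> m dvd a - b" using assms(1) by (rule split_nonzero_weight)
  then show ?thesis
    \<comment> \<open>The two copies of \<open>x\<close> share the old weight \<open>a\<close> as
      \<open>b\<close> and \<open>a - b\<close>, so neither sum changes.\<close>
    by (intro balancedI[of "add_mset (x, b) (add_mset (x, a - b) V)"])
      (use W V in \<open>auto simp: algebra_simps\<close>)
qed

lemma balanced_add_subset:
  assumes "m \<ge> 3" "balanced m M" "set_mset N \<subseteq> set_mset M"
  shows "balanced m (M + N)"
  using assms(3)
proof (induction N)
  case empty
  then show ?case using assms(2) by simp
next
  case (add x N)
  then show ?case using balanced_add_mset[OF assms(1), of "M + N" x] by auto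
qed

lemma balanced_mset_set_twice:
  assumes "m \<ge> 2" "finite E"
  shows "balanced m (mset_set E + mset_set E)"
  using assms(2)
proof induction
  case empty
  then show ?case by (simp add: balanced_empty)
next
  case (insert x E)
  have "balanced m ({#x, x#} + (mset_set E + mset_set E))"
    using balanced_pair[OF assms(1)] insert.IH by (rule balanced_add)
  then show ?case using insert by simp
qed

text \<open>Values in \<open>D\<close> are used once, in triples; all other values are used twice,
  in pairs. The terms left over repeat values already used, so they are absorbed by splitting
  weights.\<close>

lemma balanced_criterion:
  assumes m: "m \<ge> 3" and M: "set_mset M \<subseteq> {0..<m}" and D: "D \<subseteq> set_mset M" "3 dvd card D"
    and twice: "\<And>x. x \<in># M \<Longrightarrow> x \<notin> D \<Longrightarrow> count M x \<ge> 2"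
  shows "balanced m M"
proof -
  let ?E = "set_mset M - D"
  let ?B = "mset_set D + (mset_set ?E + mset_set ?E)"
  have fin: "finite D" using D(1) by (rule finite_subset) simp
  have "?B \<subseteq># M"
  proof (rule mset_subset_eqI)
    fix x
    show "count ?B x \<le> count M x"
    proof (cases "x \<in> D")
      case True
      then have "0 < count M x" using D(1) by auto
      then show ?thesis using True fin by (simp add: count_mset_set')
    next
      case False
      then show ?thesis using twice[of x] fin by (auto simp: count_mset_set')
    qed
  qed
  then have eq: "M = ?B + (M - ?B)" by (metis subset_mset.add_diff_inverse)
  have "balanced m ?B"
    using m M D by (intro balanced_add balanced_mset_set balanced_mset_set_twice) auto
  moreover have "set_mset (M - ?B) \<subseteq> set_mset ?B"
    using fin by (auto dest: in_diffD)
  ultimately have "balanced m (?B + (M - ?B))" by (rule balanced_add_subset[OF m])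
  then show ?thesis using eq by metis
qed

section \<open>Deleting one of n + 1 terms\<close>

lemma ex_balanced_remove:
  assumes n: "n \<ge> 4" and M: "set_mset M \<subseteq> {0..<int n}" "size M = n + 1"
  shows "\<exists>x\<in>#M. balanced (int n) (M - {#x#})"
proof -
  define S where "S = {x. count M x = 1}"
  define T where "T = {x. count M x \<ge> 2}"
  have S: "x \<in> S \<longleftrightarrow> count M x = 1" and T: "x \<in> T \<longleftrightarrow> count M x \<ge> 2" for x
    by (simp_all add: S_def T_def)
  \<comment> \<open>Once \<open>x\<close> is deleted, a suitable \<open>D\<close> must contain every
    value of multiplicity 1, may contain other values still present, and must have size divisible by
    3.\<close>
  have remove: ?thesis if x: "0 < count M x" and D: "3 dvd card D" and
    pos: "\<And>y. y \<in> D \<Longrightarrow> 0 < count (M - {#x#}) y" and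
    one: "\<And>y. y \<notin> D \<Longrightarrow> count (M - {#x#}) y \<noteq> 1" for x D
  proof
    show "x \<in># M" using x by simp
    show "balanced (int n) (M - {#x#})"
    proof (rule balanced_criterion)
      show "set_mset (M - {#x#}) \<subseteq> {0..<int n}" using M(1) by (blast dest: in_diffD)
      show "D \<subseteq> set_mset (M - {#x#})" using pos by (meson count_greater_zero_iff subsetI)
      show "2 \<le> count (M - {#x#}) y" if "y \<in># M - {#x#}" "y \<notin> D" for y
        using one[OF that(2)] that(1) count_greater_zero_iff[of "M - {#x#}" y] by linarith
    qed (use n D in auto)
  qed
  have "S \<subseteq> set_mset M" "T \<subseteq> set_mset M"
    using count_greater_zero_iff[of M] by (fastforce simp: S T)+
  then have fin: "finite S" "finite T" using finite_subset by blast+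
  \<comment> \<open>Pigeonhole: there are \<open>n + 1\<close> terms but only \<open>n\<close>
    residues.\<close>
  have "T \<noteq> {}"
  proof
    assume "T = {}"
    have "count M x = 1" if "x \<in># M" for x
    proof -
      have "0 < count M x" using that by simp
      moreover have "\<not> count M x \<ge> 2" using \<open>T = {}\<close> T by blast
      ultimately show ?thesis by linarith
    qed
    then have "size M = card (set_mset M)" by (simp add: size_multiset_overloaded_eq)
    also have "\<dots> \<le> card {0..<int n}" using M(1) by (intro card_mono) auto
    finally show False using M(2) by simp
  qed
  then obtain u where u: "u \<in> T" by blast
  then have "u \<notin> S" by (simp add: S T)
  consider "S \<noteq> {}" "card S mod 3 = 0" | "S = {}" | "card S mod 3 = 1" | "card S mod 3 = 2"
    by fastforce
  then show ?thesis
  proof cases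
    case 1
    \<comment> \<open>Deleting the single term \<open>w\<close> leaves one value too few; the
      repeated value \<open>u\<close> takes its place in \<open>D\<close>.\<close>
    then obtain w where w: "w \<in> S" by blast
    then have "card (insert u (S - {w})) = card S"
      using \<open>u \<notin> S\<close> fin card.remove[of S w] by simp
    then show ?thesis using 1 u w
      by (intro remove[of w "insert u (S - {w})"]) (auto simp: S T simp del: count_greater_zero_iff)
  next
    case 2
    \<comment> \<open>Without single terms, a value of multiplicity at least 3 can lose a copy and
      stay repeated, so \<open>D\<close> may be empty.\<close>
    then have not_one: "count M x \<noteq> 1" for x using S by blast
    show ?thesis
    proof (cases "\<exists>x. count M x \<ge> 3")
      case True
      then obtain x where "count M x \<ge> 3" by blast
      then show ?thesis using not_one by (intro remove[of x "{}"]) (auto simp del: count_greater_zero_iff)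
    next
      case False
      \<comment> \<open>All multiplicities are 2, so deleting \<open>x\<close> makes it single and
        \<open>D\<close> needs two further values. They exist because \<open>n + 1\<close> is at
        least 5. For \<open>n = 3\<close> this breaks down: 0, 0, 1, 1 has no solvable
        deletion.\<close>
      have two: "count M x = 2" if "x \<in># M" for x
      proof -
        have "0 < count M x" using that by simp
        moreover have "\<not> count M x \<ge> 3" using False by blast
        ultimately show ?thesis using not_one[of x] by linarith
      qed
      then have "size M = 2 * card (set_mset M)" by (simp add: size_multiset_overloaded_eq)
      then have "card (set_mset M) \<ge> 3" using M(2) n by linarith
      then obtain D where D: "D \<subseteq> set_mset M" "card D = 3" by (rule obtain_subset_with_card_n)
      then obtain x where x: "x \<in> D" by fastforce
      have "count M y = 2" if "y \<in> D" for y using that D two by blast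
      then show ?thesis using not_one D x by (intro remove[of x D]) (auto simp del: count_greater_zero_iff)
    qed
  next
    case 3
    \<comment> \<open>Here the single terms other than \<open>w\<close> already form a suitable
      \<open>D\<close>.\<close>
    then obtain w where w: "w \<in> S" by fastforce
    then have "card S = Suc (card (S - {w}))" using fin by (intro card.remove)
    then have "3 dvd card (S - {w})" using 3 by presburger
    then show ?thesis using w by (intro remove[of w "S - {w}"]) (auto simp: S simp del: count_greater_zero_iff)
  next
    case 4
    \<comment> \<open>Adding \<open>u\<close> completes the size of \<open>D\<close>, and
      \<open>u\<close> survives the deletion of one of its copies.\<close>
    have "card (insert u S) = Suc (card S)" using \<open>u \<notin> S\<close> fin by simp
    then have "3 dvd card (insert u S)" using 4 by presburger
    then show ?thesis using u by (intro remove[of u "insert u S"]) (auto simp: S T simp del: count_greater_zero_iff)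
  qed
qed

text \<open>Weights cannot be split modulo 2, but two of three terms agree and the third can be
  deleted.\<close>

lemma ex_balanced_remove_2:
  assumes M: "set_mset M \<subseteq> {0..<2}" "size M = 3"
  shows "\<exists>x\<in>#M. balanced 2 (M - {#x#})"
proof -
  obtain xs where xs: "mset xs = M" using ex_mset by blast
  then have "length xs = 3" using M(2) size_mset by metis
  then obtain x y z where "xs = [x, y, z]" by (auto simp: numeral_3_eq_3 length_Suc_conv)
  then have xyz: "M = {#x, y, z#}" using xs by auto
  have "{x, y, z} \<subseteq> {0, 1}" using M(1) xyz by auto
  then consider "x = y" | "x = z" | "y = z" by auto
  then show ?thesis
    by cases (use xyz balanced_pair[of 2] in \<open>auto simp: add_mset_commute\<close>)
qed

section \<open>From multisets back to weighted sequences\<close>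

text \<open>Used with \<open>fst\<close> to list the weighted terms in the order of the given
  sequence, so that weights can be read off by position.\<close>

lemma image_mset_eq_mset_obtain:
  assumes "image_mset f W = mset ys"
  obtains ws where "mset ws = W" "map f ws = ys"
  using assms
proof (induction ys arbitrary: W thesis)
  case Nil
  then show ?case by simp
next
  case (Cons y ys)
  then have "image_mset f W = add_mset y (mset ys)" by simp
  then obtain V w where V: "W = add_mset w V" "f w = y" "image_mset f V = mset ys"
    using msed_map_invR by metis
  obtain ws where "mset ws = V" "map f ws = ys" using Cons.IH V(3) by blast
  then show ?case using V by (intro Cons.prems(1)[of "w # ws"]) auto
qed

text \<open>Sums in the residue ring are integer sums reduced modulo \<open>n\<close>, and the
  singleton set forces every \<open>b i\<close> to be 1.\<close>

lemma weighted_zero_sum_iff: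
  assumes "n \<ge> 2"
  shows "weighted_zero_sum n A {\<one>\<^bsub>Zmod n\<^esub>} xs \<longleftrightarrow>
    (\<exists>a. (\<forall>i<length xs. a i \<in> A) \<and> int n dvd (\<Sum>i<length xs. a i * xs ! i) \<and>
      int n dvd (\<Sum>i<length xs. a i))"
proof -
  interpret residues "int n" "Zmod n" using assms by unfold_locales auto
  have sums: "(\<Oplus>\<^bsub>Zmod n\<^esub>i\<in>I. f i \<otimes>\<^bsub>Zmod n\<^esub> g i) = (\<Sum>i\<in>I. f i * g i) mod int n"
    if "finite I" for I :: "nat set" and f g
    using sum_cong[OF that, of "\<lambda>i. f i * g i"] by (simp add: res_mult_eq)
  have ones: "(\<Sum>i<k. b i * a i) = (\<Sum>i<k. a i)" if "\<forall>i<k. b i = 1" for a b :: "nat \<Rightarrow> int" and k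
    using that by (intro sum.cong) auto
  show ?thesis
  proof
    assume "weighted_zero_sum n A {\<one>\<^bsub>Zmod n\<^esub>} xs"
    then show "\<exists>a. (\<forall>i<length xs. a i \<in> A) \<and> int n dvd (\<Sum>i<length xs. a i * xs ! i) \<and>
      int n dvd (\<Sum>i<length xs. a i)"
      unfolding weighted_zero_sum_def
      by (auto simp: sums res_zero_eq res_one_eq mod_eq_0_iff_dvd ones)
  next
    assume "\<exists>a. (\<forall>i<length xs. a i \<in> A) \<and> int n dvd (\<Sum>i<length xs. a i * xs ! i) \<and>
      int n dvd (\<Sum>i<length xs. a i)"
    then obtain a where "\<forall>i<length xs. a i \<in> A" "int n dvd (\<Sum>i<length xs. a i * xs ! i)"
      "int n dvd (\<Sum>i<length xs. a i)" by blast
    then show "weighted_zero_sum n A {\<one>\<^bsub>Zmod n\<^esub>} xs"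
      unfolding weighted_zero_sum_def
      by (intro exI[of _ a] exI[of _ "\<lambda>_. 1"])
        (simp add: sums res_zero_eq res_one_eq mod_eq_0_iff_dvd)
  qed
qed

lemma nonzero_carrier_Zmod:
  assumes "n \<ge> 2"
  shows "carrier (Zmod n) - {\<zero>\<^bsub>Zmod n\<^esub>} = {1..<int n}"
proof -
  interpret residues "int n" "Zmod n" using assms by unfold_locales auto
  show ?thesis by (auto simp: res_carrier_eq res_zero_eq)
qed

lemma balanced_imp_weighted_zero_sum:
  assumes n: "n \<ge> 2" and ys: "balanced (int n) (mset ys)"
  shows "weighted_zero_sum n (carrier (Zmod n) - {\<zero>\<^bsub>Zmod n\<^esub>}) {\<one>\<^bsub>Zmod n\<^esub>} ys"
proof -
  obtain W where W: "image_mset fst W = mset ys" "\<forall>(x, a)\<in>#W. \<not> int n dvd a"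
    "int n dvd (\<Sum>(x, a)\<in>#W. a)" "int n dvd (\<Sum>(x, a)\<in>#W. a * x)"
    using ys by (rule balancedE)
  obtain ws where ws: "mset ws = W" "map fst ws = ys"
    using W(1) by (rule image_mset_eq_mset_obtain)
  have len: "length ys = length ws" and nth: "\<And>i. i < length ws \<Longrightarrow> ys ! i = fst (ws ! i)"
    using ws(2) by auto
  have sum: "(\<Sum>w\<in>#W. f w) = (\<Sum>i<length ws. f (ws ! i))" for f :: "int \<times> int \<Rightarrow> int"
  proof -
    have "(\<Sum>w\<in>#W. f w) = sum_list (map f ws)"
      by (simp only: ws(1)[symmetric] mset_map[symmetric] sum_mset_sum_list)
    then show ?thesis by (simp add: sum_list_sum_nth atLeast0LessThan)
  qed
  \<comment> \<open>Reduction moves the weights into the carrier; they stay nonzero, and both sums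
    keep their residues.\<close>
  define a where "a i = snd (ws ! i) mod int n" for i
  have "a i \<in> {1..<int n}" if "i < length ys" for i
  proof -
    have "ws ! i \<in># W" using that len ws(1) nth_mem[of i ws] by auto
    then have "a i \<noteq> 0" using bspec[OF W(2), of "ws ! i"]
      by (simp add: a_def mod_eq_0_iff_dvd case_prod_beta)
    moreover have "0 \<le> a i" "a i < int n" using n by (simp_all add: a_def)
    ultimately show ?thesis by auto
  qed
  moreover have "int n dvd (\<Sum>i<length ys. a i * ys ! i)"
  proof -
    have "[\<Sum>i<length ys. a i * ys ! i = \<Sum>i<length ys. snd (ws ! i) * fst (ws ! i)] (mod int n)"
      by (intro cong_sum) (simp add: cong_def a_def nth len mod_mult_left_eq)
    then show ?thesis using W(4) by (simp add: sum len case_prod_beta cong_dvd_iff)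
  qed
  moreover have "int n dvd (\<Sum>i<length ys. a i)"
  proof -
    have "[\<Sum>i<length ys. a i = \<Sum>i<length ys. snd (ws ! i)] (mod int n)"
      by (intro cong_sum) (simp add: cong_def a_def)
    then show ?thesis using W(3) by (simp add: sum len case_prod_beta cong_dvd_iff)
  qed
  ultimately show ?thesis
    unfolding weighted_zero_sum_iff[OF n] nonzero_carrier_Zmod[OF n] by blast
qed

section \<open>The extremal sequence and the value of the constant\<close>

text \<open>Only the last term contributes to the first sum, so its weight, lying between 1 and
  \<open>n - 1\<close>, would have to be divisible by \<open>n\<close>.\<close>

lemma not_weighted_zero_sum_zeros_one:
  assumes n: "n \<ge> 2"
  shows "\<not> weighted_zero_sum n (carrier (Zmod n) - {\<zero>\<^bsub>Zmod n\<^esub>}) {\<one>\<^bsub>Zmod n\<^esub>} (replicate k 0 @ [1])"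
proof
  assume "weighted_zero_sum n (carrier (Zmod n) - {\<zero>\<^bsub>Zmod n\<^esub>}) {\<one>\<^bsub>Zmod n\<^esub>} (replicate k 0 @ [1])"
  then obtain a where a: "\<forall>i<Suc k. a i \<in> {1..<int n}"
    "int n dvd (\<Sum>i<Suc k. a i * (replicate k 0 @ [1]) ! i)"
    unfolding weighted_zero_sum_iff[OF n] nonzero_carrier_Zmod[OF n] by auto
  have "(\<Sum>i<Suc k. a i * (replicate k 0 @ [1]) ! i) = a k"
    by (simp add: nth_append)
  then show False using a zdvd_not_zless[of "a k" "int n"] by auto
qed

theorem theorem7:
  fixes n :: nat
  assumes "n \<ge> 2" and "n \<noteq> 3"
  shows "E_const (carrier (Zmod n) - {\<zero>\<^bsub>Zmod n\<^esub>}) {\<one>\<^bsub>Zmod n\<^esub>} n = n + 1"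
proof -
  interpret residues "int n" "Zmod n" using assms(1) by unfold_locales auto
  let ?wzs = "weighted_zero_sum n (carrier (Zmod n) - {\<zero>\<^bsub>Zmod n\<^esub>}) {\<one>\<^bsub>Zmod n\<^esub>}"
  have carrier: "carrier (Zmod n) = {0..<int n}" by (auto simp: res_carrier_eq)
  have upper: "\<exists>ys. ys \<noteq> [] \<and> subseq ys xs \<and> length ys = n \<and> ?wzs ys"
    if "set xs \<subseteq> carrier (Zmod n)" "length xs = n + 1" for xs
  proof -
    have "\<exists>x\<in>#mset xs. balanced (int n) (mset xs - {#x#})"
    proof (cases "n = 2")
      case True
      then show ?thesis using that ex_balanced_remove_2[of "mset xs"] unfolding carrier by simp
    next
      case False
      then show ?thesis using assms that ex_balanced_remove[of n "mset xs"] unfolding carrier by simp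
    qed
    then obtain x where x: "x \<in> set xs" "balanced (int n) (mset xs - {#x#})" by auto
    \<comment> \<open>Solvability depends only on the multiset, so any occurrence of
      \<open>x\<close> may be cut out of the sequence.\<close>
    then obtain us vs where xs: "xs = us @ x # vs" by (meson split_list)
    have "mset xs - {#x#} = mset (us @ vs)" by (simp add: xs)
    then have "?wzs (us @ vs)"
      using assms(1) x(2) by (intro balanced_imp_weighted_zero_sum) simp_all
    moreover have "subseq (us @ vs) xs" "length (us @ vs) = n"
      using that(2) by (auto simp: xs subseq_append' intro: list_emb_Cons)
    ultimately show ?thesis using assms(1) by (intro exI[of _ "us @ vs"]) auto
  qed
  have lower: "n + 1 \<le> k" if "0 < k" and
    sub: "\<And>xs. set xs \<subseteq> carrier (Zmod n) \<Longrightarrow> length xs = k \<Longrightarrow>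
      \<exists>ys. ys \<noteq> [] \<and> subseq ys xs \<and> length ys = n \<and> ?wzs ys" for k
  proof (rule ccontr)
    assume "\<not> n + 1 \<le> k"
    \<comment> \<open>Since \<open>k\<close> is at most \<open>n\<close>, a subsequence of length
      \<open>n\<close> can only be the whole sequence.\<close>
    let ?xs = "replicate (k - 1) 0 @ [1 :: int]"
    have "set ?xs \<subseteq> carrier (Zmod n)" "length ?xs = k"
      using assms(1) \<open>0 < k\<close> by (auto simp: carrier)
    then obtain ys where ys: "subseq ys ?xs" "length ys = n" "?wzs ys" using sub by blast
    then have "ys = ?xs"
      using \<open>\<not> n + 1 \<le> k\<close> \<open>length ?xs = k\<close> list_emb_length[OF ys(1)]
      by (intro subseq_same_length) auto
    then show False using ys(3) not_weighted_zero_sum_zeros_one[OF assms(1)] by simp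
  qed
  show ?thesis
    unfolding E_const_def
  proof (rule cInf_eq_minimum, goal_cases)
    case 1
    show ?case using upper by simp
  next
    case (2 k)
    show ?case
    proof (rule lower)
      show "0 < k" using 2 by simp
    qed (use 2 in blast)
  qed
qed

end
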